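(* Let $n\ge 2$ and let $\Gamma$ be a smooth curve in $\mathbb{R}^n$, with parameter $x$ starting at $x=0$, regarded as the trajectory of the front wheel of a bicycle of length $1$. For every $x$, let $M_x:S^{n-1}\to S^{n-1}$ be the time-$x$ bicycle monodromy map along $\Gamma$. Then for all $x$ one has $M_x\in O(n,1)$, i.e. $M_x$ is the transformation of $S^{n-1}$ induced by an element of the Möbius group $O(n,1)$.
   Context: A bicycle of length $1$ in $\mathbb{R}^n$ is an oriented unit segment $AB$ ($A$ is the rear wheel, $B$ the front wheel) that moves so that the velocity of $A$ is always parallel to the segment $AB$. If the front wheel moves along $B=\Gamma(x)$, the positions of the bicycle with front wheel at $\Gamma(x)$ form the unit sphere centered at $\Gamma(x)$; these spheres are identified with the standard unit sphere $S^{n-1}\subset\mathbb{R}^n$ by parallel translation, i.e. a position is recorded by $u=A-B\in S^{n-1}$. The motion is then governed by the ODE $u'(x)=-\Gamma'(x)+(\Gamma'(x)\cdot u(x))\,u(x)$. The monodromy map $M_x$ sends the initial position $u(0)$ to the position $u(x)$. The Möbius group $O(n,1)$ consists of the linear transformations of $\mathbb{R}^{n+1}$ (coordinates $x_1,\dots,x_n,x_0$) preserving the quadratic form $x_0^2-x_1^2-\dots-x_n^2$. It acts on the null cone $x_1^2+\dots+x_n^2=x_0^2$ and hence on its spherization (projectivization), which is identified with $S^{n-1}$ by $r\mapsto$ the class of $(r,1)$; this is the action on the sphere at infinity of hyperbolic space $H^n$. *)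

theory Defs
  imports "HOL-Analysis.Analysis"
begin

section \<open>Bicycle motion\<close>

text \<open>\<open>C\<^sup>\<infinity>\<close> on a set of parameters, with derivatives taken within that set
  (so one-sided at an end point of an interval); \<open>D k\<close> is the \<open>k\<close>-th derivative.\<close>

definition smooth_curve_on :: "real set \<Rightarrow> (real \<Rightarrow> 'a::real_normed_vector) \<Rightarrow> bool" where
  "smooth_curve_on I \<Gamma> \<longleftrightarrow>
    (\<exists>D. (\<forall>t\<in>I. D 0 t = \<Gamma> t) \<and>
         (\<forall>k::nat. \<forall>t\<in>I. (D k has_vector_derivative D (Suc k) t) (at t within I)))"

text \<open>The position is recorded by \<open>u = A - B\<close> with \<open>B = \<Gamma>\<close>, so the rear wheel is \<open>A = \<Gamma> + u\<close>.
  The second conjunct is the no-skid condition: the velocity of \<open>A\<close> is parallel to the segment.\<close>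

definition bicycle_motion ::
    "real set \<Rightarrow> (real \<Rightarrow> 'a::real_inner) \<Rightarrow> (real \<Rightarrow> 'a) \<Rightarrow> bool" where
  "bicycle_motion J \<Gamma> u \<longleftrightarrow>
    (\<forall>t\<in>J. u t \<in> sphere 0 1 \<and>
           (\<exists>c. ((\<lambda>s. \<Gamma> s + u s) has_vector_derivative c *\<^sub>R u t) (at t within J)))"

lemma bicycle_motion_iff_ODE:
  fixes \<Gamma> u \<Gamma>' :: "real \<Rightarrow> 'a::real_inner"
  assumes \<Gamma>: "\<And>t. t \<in> J \<Longrightarrow> (\<Gamma> has_vector_derivative \<Gamma>' t) (at t within J)"
  shows "bicycle_motion J \<Gamma> u \<longleftrightarrow>
    (\<forall>t\<in>J. u t \<in> sphere 0 1 \<and>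
           (u has_vector_derivative - \<Gamma>' t + (\<Gamma>' t \<bullet> u t) *\<^sub>R u t) (at t within J))"
proof
  assume ode: "\<forall>t\<in>J. u t \<in> sphere 0 1 \<and>
      (u has_vector_derivative - \<Gamma>' t + (\<Gamma>' t \<bullet> u t) *\<^sub>R u t) (at t within J)"
  have "((\<lambda>s. \<Gamma> s + u s) has_vector_derivative (\<Gamma>' t \<bullet> u t) *\<^sub>R u t) (at t within J)"
    if "t \<in> J" for t
    using has_vector_derivative_add[OF \<Gamma>[OF that] conjunct2[OF ode[rule_format, OF that]]] by simp
  with ode show "bicycle_motion J \<Gamma> u"
    unfolding bicycle_motion_def by blast
next
  assume bm: "bicycle_motion J \<Gamma> u"
  show "\<forall>t\<in>J. u t \<in> sphere 0 1 \<and>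
      (u has_vector_derivative - \<Gamma>' t + (\<Gamma>' t \<bullet> u t) *\<^sub>R u t) (at t within J)"
  proof (intro ballI conjI)
    fix t assume t: "t \<in> J"
    show "u t \<in> sphere 0 1" using bm t by (auto simp: bicycle_motion_def)
    then have uu: "u t \<bullet> u t = 1" by (simp add: norm_eq_1)
    obtain c where c: "((\<lambda>s. \<Gamma> s + u s) has_vector_derivative c *\<^sub>R u t) (at t within J)"
      using bm t by (auto simp: bicycle_motion_def)
    have u': "(u has_vector_derivative c *\<^sub>R u t - \<Gamma>' t) (at t within J)"
      using has_vector_derivative_diff[OF c \<Gamma>[OF t]] by simp
    show "(u has_vector_derivative - \<Gamma>' t + (\<Gamma>' t \<bullet> u t) *\<^sub>R u t) (at t within J)"
    proof (cases "at t within J = bot")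
      case True
      then show ?thesis
        by (simp add: has_vector_derivative_def has_derivative_def bounded_linear_scaleR_left)
    next
      case False
      have "((\<lambda>s. u s \<bullet> u s) has_derivative
          (\<lambda>h. u t \<bullet> (h *\<^sub>R (c *\<^sub>R u t - \<Gamma>' t)) + (h *\<^sub>R (c *\<^sub>R u t - \<Gamma>' t)) \<bullet> u t)) (at t within J)"
        using u' unfolding has_vector_derivative_def by (intro has_derivative_inner)
      then have "((\<lambda>s. u s \<bullet> u s) has_vector_derivative 2 * (c - \<Gamma>' t \<bullet> u t)) (at t within J)"
        unfolding has_vector_derivative_def
        by (rule has_derivative_eq_rhs)
          (auto simp: fun_eq_iff inner_diff_left inner_diff_right uu inner_commute algebra_simps)
      then have "((\<lambda>_. 1::real) has_vector_derivative 2 * (c - \<Gamma>' t \<bullet> u t)) (at t within J)"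
        by (rule has_vector_derivative_transform[OF t, rotated])
          (use bm in \<open>auto simp: bicycle_motion_def norm_eq_1\<close>)
      then have "2 * (c - \<Gamma>' t \<bullet> u t) = 0"
        using False has_vector_derivative_const vector_derivative_unique_within by blast
      with u' show ?thesis by simp
    qed
  qed
qed

text \<open>\<open>monodromy \<Gamma> x\<close> is \<open>M\<^sub>x\<close>. It is meaningful on the unit sphere for \<open>\<Gamma>\<close> smooth on
  \<open>{0..x}\<close>, where the motion with a given initial position exists and is unique.\<close>

definition monodromy :: "(real \<Rightarrow> 'a::real_inner) \<Rightarrow> real \<Rightarrow> 'a \<Rightarrow> 'a" where
  "monodromy \<Gamma> x v = (THE w. \<exists>u. bicycle_motion {0..x} \<Gamma> u \<and> u 0 = v \<and> u x = w)"

section \<open>The group O(n,1) and its action on the sphere\<close>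

text \<open>\<open>\<real>\<^sup>n\<^sup>+\<^sup>1\<close> is modelled as \<open>\<real>\<^sup>n \<times> \<real>\<close>, the last factor carrying the coordinate \<open>x\<^sub>0\<close>.\<close>

definition lorentz_form :: "'a::real_inner \<times> real \<Rightarrow> real" where
  "lorentz_form z = (snd z)\<^sup>2 - fst z \<bullet> fst z"

definition moebius_group :: "('a::real_inner \<times> real \<Rightarrow> 'a \<times> real) set" where
  "moebius_group = {g. linear g \<and> (\<forall>z. lorentz_form (g z) = lorentz_form z)}"

definition null_cone :: "('a::real_inner \<times> real) set" where
  "null_cone = {z. fst z \<bullet> fst z = (snd z)\<^sup>2}"

text \<open>The point of projective space represented by \<open>z\<close>. Classes are taken modulo all nonzero
  scalars, not only positive ones: elements of O(n,1) may exchange the two halves of the cone.\<close>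

definition proj_class :: "'a::real_vector \<Rightarrow> 'a set" where
  "proj_class z = {c *\<^sub>R z | c. c \<noteq> 0}"

definition sphere_class :: "'a::real_inner \<Rightarrow> ('a \<times> real) set" where
  "sphere_class r = proj_class (r, 1)"

lemma bij_betw_sphere_class:
  "bij_betw sphere_class (sphere (0::'a::real_inner) 1) (proj_class ` (null_cone - {0}))"
proof (intro bij_betw_imageI inj_onI equalityI subsetI)
  fix r s :: 'a assume "sphere_class r = sphere_class s"
  moreover have "(r, 1) \<in> sphere_class r"
    unfolding sphere_class_def proj_class_def by (force intro: exI[of _ 1])
  ultimately show "r = s" by (auto simp: sphere_class_def proj_class_def)
next
  fix K :: "('a \<times> real) set" assume "K \<in> sphere_class ` sphere 0 1"
  then show "K \<in> proj_class ` (null_cone - {0})"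
    by (auto simp: sphere_class_def null_cone_def norm_eq_1 zero_prod_def intro!: imageI)
next
  fix K :: "('a \<times> real) set" assume "K \<in> proj_class ` (null_cone - {0})"
  then obtain z where "z \<in> null_cone" "z \<noteq> 0" "K = proj_class z" by blast
  then obtain y t where K: "K = proj_class (y, t)" and yt: "y \<bullet> y = t\<^sup>2" "(y, t) \<noteq> 0"
    unfolding null_cone_def by (cases z) simp
  then have t: "t \<noteq> 0" by (auto simp: zero_prod_def)
  have "c *\<^sub>R (y, t) = (c * t) *\<^sub>R (y /\<^sub>R t, 1)" "c *\<^sub>R (y /\<^sub>R t, 1) = (c / t) *\<^sub>R (y, t)" for c
    using t by (auto simp: field_simps)
  then have "(\<exists>c. z = c *\<^sub>R (y, t) \<and> c \<noteq> 0) \<longleftrightarrow> (\<exists>c. z = c *\<^sub>R (y /\<^sub>R t, 1) \<and> c \<noteq> 0)" for z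
    using t by (metis divide_eq_0_iff mult_eq_0_iff)
  then have "K = sphere_class (y /\<^sub>R t)"
    unfolding K sphere_class_def proj_class_def by simp
  moreover have "y /\<^sub>R t \<in> sphere 0 1"
    using yt t by (simp add: norm_eq_sqrt_inner) (simp add: power2_eq_square field_simps)
  ultimately show "K \<in> sphere_class ` sphere 0 1" by blast
qed

text \<open>Linear maps act on classes by taking images. The following says that, under the
  identification \<open>sphere_class\<close>, the action of \<open>g\<close> on the projectivized null cone is \<open>M\<close>.\<close>

definition induces_on_sphere ::
    "('a::real_inner \<times> real \<Rightarrow> 'a \<times> real) \<Rightarrow> ('a \<Rightarrow> 'a) \<Rightarrow> bool" where
  "induces_on_sphere g M \<longleftrightarrow>
    (\<forall>r\<in>sphere 0 1. M r \<in> sphere 0 1 \<and> g ` sphere_class r = sphere_class (M r))"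

end

theory Submission
  imports Defs
begin

text \<open>Writing \<open>u = y / s\<close> turns the bicycle equation into the linear system \<open>y' = - s \<Gamma>'\<close>,
  \<open>s' = - \<Gamma>' \<bullet> y\<close>, whose matrix lies in the Lie algebra of \<open>O(n,1)\<close>. Hence its solution operator
  lies in \<open>O(n,1)\<close>, and its action on the null directions \<open>(u, 1)\<close> is the monodromy.\<close>

section \<open>Linear differential equations\<close>

text \<open>The integrating factor \<open>exp (- L * s)\<close> turns the inequality into a
  nonpositive derivative, and the mean value theorem does the rest. The sign of \<open>L\<close> is
  arbitrary: a negative \<open>L\<close> later bounds a decay rate.\<close>

lemma gronwall_differential:
  fixes f :: "real \<Rightarrow> real"
  assumes f': "\<And>t. t \<in> {0..b} \<Longrightarrow> (f has_vector_derivative f' t) (at t within {0..b})"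
    and le: "\<And>t. t \<in> {0..b} \<Longrightarrow> f' t \<le> L * f t"
    and t: "t \<in> {0..b}"
  shows "f t \<le> f 0 * exp (L * t)"
proof -
  define g where "g s = f s * exp (- L * s)" for s
  have g': "(g has_derivative (\<lambda>h. h * ((f' s - L * f s) * exp (- L * s)))) (at s within {0..t})"
    if "0 \<le> s" "s \<le> t" for s
  proof -
    have "(f has_real_derivative f' s) (at s within {0..t})"
      using f'[of s] that t
      by (auto simp: has_real_derivative_iff_has_vector_derivative
          intro: has_vector_derivative_within_subset)
    then have "(g has_real_derivative (f' s - L * f s) * exp (- L * s)) (at s within {0..t})"
      unfolding g_def by (auto intro!: derivative_eq_intros simp: algebra_simps)
    then show ?thesis
      by (simp only: has_field_derivative_def mult_commute_abs)
  qed
  obtain s where s: "s \<in> {0..t}"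
    and eq: "g t - g 0 = (t - 0) * ((f' s - L * f s) * exp (- L * s))"
    using mvt_very_simple[OF _ g'] t by auto
  have "(t - 0) * ((f' s - L * f s) * exp (- L * s)) \<le> 0"
    using le[of s] s t by (intro mult_nonneg_nonpos mult_nonpos_nonneg) auto
  with eq have "g t \<le> f 0"
    by (simp add: g_def)
  then have "g t * exp (L * t) \<le> f 0 * exp (L * t)"
    by (intro mult_right_mono) auto
  then show ?thesis
    by (simp add: g_def mult.assoc flip: exp_add)
qed

lemma has_vector_derivative_inner_self:
  fixes w :: "real \<Rightarrow> 'a::real_inner"
  assumes "(w has_vector_derivative w') (at t within S)"
  shows "((\<lambda>s. w s \<bullet> w s) has_vector_derivative 2 * (w t \<bullet> w')) (at t within S)"
  using bounded_bilinear.has_vector_derivative[OF bounded_bilinear_inner assms assms]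
  by (simp add: inner_commute)

text \<open>Gronwall for the squared norm, which starts at 0. Applied to a difference of two
  solutions it gives uniqueness, both for the nonlinear bicycle equation and for the linear
  system.\<close>

lemma gronwall_inner_eq_0:
  fixes w :: "real \<Rightarrow> 'a::real_inner"
  assumes w': "\<And>t. t \<in> {0..b} \<Longrightarrow> (w has_vector_derivative w' t) (at t within {0..b})"
    and le: "\<And>t. t \<in> {0..b} \<Longrightarrow> w t \<bullet> w' t \<le> L * (w t \<bullet> w t)"
    and "w 0 = 0" "t \<in> {0..b}"
  shows "w t = 0"
proof -
  \<comment> \<open>The rate is \<open>2 * L\<close> because the derivative of
    \<open>w \<bullet> w\<close> is twice \<open>w \<bullet> w'\<close>.\<close>
  have "w t \<bullet> w t \<le> (w 0 \<bullet> w 0) * exp (2 * L * t)"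
    by (rule gronwall_differential[OF has_vector_derivative_inner_self[OF w']])
      (use le assms(4) in \<open>auto simp: mult.assoc\<close>)
  then have "w t \<bullet> w t = 0"
    using \<open>w 0 = 0\<close> inner_ge_zero[of "w t"] by simp
  then show ?thesis
    by simp
qed

section \<open>Existence of solutions by the Picard series\<close>

text \<open>These are the summands of the series of iterated integrals for
  \<open>y' = h (a t) y\<close>, \<open>y 0 = v\<close>. The partial sums are the Picard iterates,
  so each summand is the difference of two successive iterates.\<close>

primrec picard_term ::
    "('a \<Rightarrow> 'b::banach \<Rightarrow> 'b) \<Rightarrow> (real \<Rightarrow> 'a) \<Rightarrow> 'b \<Rightarrow> nat \<Rightarrow> real \<Rightarrow> 'b" where
  "picard_term h a v 0 = (\<lambda>t. v)"
| "picard_term h a v (Suc k) = (\<lambda>t. integral {0..t} (\<lambda>s. h (a s) (picard_term h a v k s)))"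

lemma continuous_on_picard_term:
  fixes h :: "'a::real_normed_vector \<Rightarrow> 'b::banach \<Rightarrow> 'b"
  assumes "bounded_bilinear h" "continuous_on {0..b} a"
  shows "continuous_on {0..b} (picard_term h a v k)"
proof (induction k)
  case (Suc k)
  show ?case
    unfolding picard_term.simps
    by (intro indefinite_integral_continuous_1 integrable_continuous_real
        bounded_bilinear.continuous_on[OF assms] Suc)
qed simp

lemma has_vector_derivative_picard_term_Suc:
  fixes h :: "'a::real_normed_vector \<Rightarrow> 'b::banach \<Rightarrow> 'b"
  assumes "bounded_bilinear h" "continuous_on {0..b} a" "t \<in> {0..b}"
  shows "(picard_term h a v (Suc k) has_vector_derivative h (a t) (picard_term h a v k t))
    (at t within {0..b})"
  unfolding picard_term.simps
  by (intro integral_has_vector_derivative assms bounded_bilinear.continuous_on[OF assms(1,2)]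
      continuous_on_picard_term)

lemma norm_picard_term_le:
  fixes h :: "'a::real_normed_vector \<Rightarrow> 'b::banach \<Rightarrow> 'b"
  assumes h: "bounded_bilinear h" and a: "continuous_on {0..b} a"
    and L: "\<And>t y. t \<in> {0..b} \<Longrightarrow> norm (h (a t) y) \<le> L * norm y" and "L \<ge> 0"
    and "t \<in> {0..b}"
  shows "norm (picard_term h a v k t) \<le> norm v * ((L * t) ^ k / fact k)"
  using \<open>t \<in> {0..b}\<close>
proof (induction k arbitrary: t)
  case (Suc k)
  \<comment> \<open>\<open>?p\<close> is \<open>L\<close> times the bound for \<open>k\<close>; its
    antiderivative vanishing at 0 is exactly the bound for \<open>Suc k\<close>.\<close>
  let ?p = "\<lambda>s. norm v * (L * (L * s) ^ k / fact k)"
  have "((\<lambda>s. norm v * ((L * s) ^ Suc k / fact (Suc k))) has_real_derivative ?p s)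
      (at s within {0..t})" for s
  proof -
    have "((\<lambda>s. (L * s) ^ Suc k) has_real_derivative real (Suc k) * (L * (L * s) ^ k))
        (at s within {0..t})"
      using DERIV_power[OF DERIV_cmult_Id[of L], where n = "Suc k"] by (simp add: mult.assoc)
    from DERIV_cmult[OF DERIV_cdivide[OF this, of "fact (Suc k)"], of "norm v"] show ?thesis
      by (simp del: of_nat_Suc power_Suc)
  qed
  then have p: "(?p has_integral norm v * ((L * t) ^ Suc k / fact (Suc k))) {0..t}"
    using fundamental_theorem_of_calculus
      [of 0 t "\<lambda>s. norm v * ((L * s) ^ Suc k / fact (Suc k))" ?p] Suc.prems
    by (simp add: has_real_derivative_iff_has_vector_derivative)
  have "continuous_on {0..t} (\<lambda>s. h (a s) (picard_term h a v k s))"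
    using Suc.prems
    by (intro continuous_on_subset[OF bounded_bilinear.continuous_on
          [OF h a continuous_on_picard_term[OF h a]]]) auto
  then have "norm (picard_term h a v (Suc k) t) \<le> integral {0..t} ?p"
    unfolding picard_term.simps
  proof (intro integral_norm_bound_integral integrable_continuous_real)
    fix s assume s: "s \<in> {0..t}"
    have "norm (h (a s) (picard_term h a v k s)) \<le> L * norm (picard_term h a v k s)"
      using s Suc.prems by (intro L) auto
    also have "\<dots> \<le> L * (norm v * ((L * s) ^ k / fact k))"
      using s Suc.prems \<open>L \<ge> 0\<close> by (intro mult_left_mono Suc.IH) auto
    finally show "norm (h (a s) (picard_term h a v k s)) \<le> ?p s"
      by (simp add: ac_simps)
  qed (auto intro!: continuous_intros)
  also have "\<dots> = norm v * ((L * t) ^ Suc k / fact (Suc k))"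
    using p by (rule integral_unique)
  finally show ?case .
qed simp

text \<open>Compactness bounds the coefficient \<open>a\<close>, which makes the Lipschitz constant
  of the linear equation uniform in time.\<close>

lemma bounded_bilinear_compact_bound:
  fixes h :: "'a::real_normed_vector \<Rightarrow> 'b::real_normed_vector \<Rightarrow> 'c::real_normed_vector"
  assumes h: "bounded_bilinear h" and "compact S" "continuous_on S a"
  obtains L where "L \<ge> 0" "\<And>t y. t \<in> S \<Longrightarrow> norm (h (a t) y) \<le> L * norm y"
proof -
  obtain K where K: "K > 0" "\<And>x y. norm (h x y) \<le> norm x * norm y * K"
    using bounded_bilinear.pos_bounded[OF h] by blast
  have "bounded (a ` S)"
    by (intro compact_imp_bounded compact_continuous_image assms)
  then obtain B where B: "B > 0" "\<And>t. t \<in> S \<Longrightarrow> norm (a t) \<le> B"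
    by (auto simp: bounded_pos)
  have "norm (h (a t) y) \<le> (B * K) * norm y" if "t \<in> S" for t y
  proof -
    have "norm (a t) * norm y * K \<le> B * norm y * K"
      using B(2)[OF that] K(1) by (intro mult_right_mono) auto
    with K(2)[of "a t" y] show ?thesis
      by (simp add: ac_simps)
  qed
  with B(1) K(1) that[of "B * K"] show ?thesis
    by simp
qed

text \<open>The Picard terms are dominated by the exponential series, so their sum converges
  uniformly. The differentiated series is \<open>h (a t)\<close> applied to the partial sums, so it
  converges uniformly as well, and termwise differentiation yields the equation.\<close>

lemma linear_ode_exists:
  fixes h :: "'a::real_normed_vector \<Rightarrow> 'b::banach \<Rightarrow> 'b"
  assumes h: "bounded_bilinear h" and a: "continuous_on {0..b} a" and "b \<ge> 0"
  obtains z where "z 0 = v"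
    "\<And>t. t \<in> {0..b} \<Longrightarrow> (z has_vector_derivative h (a t) (z t)) (at t within {0..b})"
proof -
  interpret h: bounded_bilinear h by fact
  obtain L where "L \<ge> 0" and L: "\<And>t y. t \<in> {0..b} \<Longrightarrow> norm (h (a t) y) \<le> L * norm y"
    using bounded_bilinear_compact_bound[OF h compact_Icc a] by blast
  define f where "f = picard_term h a v"
  \<comment> \<open>Term 0 is constant, with derivative 0; differentiating any later term removes
    its outer integral.\<close>
  define f' where "f' k t = (case k of 0 \<Rightarrow> 0 | Suc j \<Rightarrow> h (a t) (f j t))" for k t
  define z where "z t = (\<Sum>k. f k t)" for t
  have f': "(f k has_vector_derivative f' k t) (at t within {0..b})" if "t \<in> {0..b}" for k t
    using has_vector_derivative_picard_term_Suc[OF h a that, of v]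
    by (auto simp: f_def f'_def split: nat.split)
  \<comment> \<open>The estimate at \<open>t\<close> is weakened to its value at \<open>b\<close>,
    since the M-test needs constants independent of \<open>t\<close>.\<close>
  have bound: "norm (f k t) \<le> norm v * ((L * b) ^ k / fact k)" if "t \<in> {0..b}" for k t
  proof -
    have "norm (f k t) \<le> norm v * ((L * t) ^ k / fact k)"
      unfolding f_def by (intro norm_picard_term_le[OF h a L]) (use that \<open>L \<ge> 0\<close> in auto)
    also have "\<dots> \<le> norm v * ((L * b) ^ k / fact k)"
      using that \<open>L \<ge> 0\<close> by (intro mult_left_mono divide_right_mono power_mono) auto
    finally show ?thesis .
  qed
  have summable_bound: "summable (\<lambda>k. norm v * ((L * b) ^ k / fact k))"
    using summable_exp[of "L * b"] by (intro summable_mult) (simp add: field_simps)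
  have unif: "uniform_limit {0..b} (\<lambda>n t. \<Sum>k<n. f k t) z sequentially"
    unfolding z_def using bound summable_bound by (rule Weierstrass_m_test)
  \<comment> \<open>The index shift: since the derivative of term 0 vanishes, \<open>Suc n\<close>
    derivatives correspond to \<open>n\<close> terms of the series.\<close>
  have sum_f': "(\<Sum>k<Suc n. f' k t) = h (a t) (\<Sum>k<n. f k t)" for n t
    unfolding sum.lessThan_Suc_shift by (simp add: f'_def h.sum_right)
  have unif': "\<forall>\<^sub>F n in sequentially. \<forall>t\<in>{0..b}. \<forall>d.
      norm ((\<Sum>k<n. d *\<^sub>R f' k t) - d *\<^sub>R h (a t) (z t)) \<le> e * norm d" if "e > 0" for e :: real
  proof -
    \<comment> \<open>The divisor \<open>L + 1\<close> instead of \<open>L\<close> covers the case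
      \<open>L = 0\<close>.\<close>
    have "\<forall>\<^sub>F n in sequentially. \<forall>t\<in>{0..b}. dist (\<Sum>k<n. f k t) (z t) < e / (L + 1)"
      using uniform_limitD[OF unif, of "e / (L + 1)"] \<open>e > 0\<close> \<open>L \<ge> 0\<close> by simp
    then have "\<forall>\<^sub>F n in sequentially. \<forall>t\<in>{0..b}. \<forall>d.
      norm ((\<Sum>k<Suc n. d *\<^sub>R f' k t) - d *\<^sub>R h (a t) (z t)) \<le> e * norm d"
    proof (rule eventually_mono, intro ballI allI)
      fix n t and d :: real
      assume "\<forall>t\<in>{0..b}. dist (\<Sum>k<n. f k t) (z t) < e / (L + 1)" and t: "t \<in> {0..b}"
      then have "norm ((\<Sum>k<n. f k t) - z t) \<le> e / (L + 1)"
        by (auto simp: dist_norm intro: less_imp_le)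
      then have "L * norm ((\<Sum>k<n. f k t) - z t) \<le> (L + 1) * (e / (L + 1))"
        using \<open>L \<ge> 0\<close> by (intro mult_mono) auto
      then have "norm (h (a t) ((\<Sum>k<n. f k t) - z t)) \<le> e"
        using L[OF t, of "(\<Sum>k<n. f k t) - z t"] \<open>L \<ge> 0\<close> by simp
      then have "norm d * norm (h (a t) ((\<Sum>k<n. f k t) - z t)) \<le> norm d * e"
        by (intro mult_left_mono) auto
      then show "norm ((\<Sum>k<Suc n. d *\<^sub>R f' k t) - d *\<^sub>R h (a t) (z t)) \<le> e * norm d"
        unfolding scaleR_sum_right[symmetric] sum_f' scaleR_diff_right[symmetric]
          h.diff_right[symmetric]
        by (simp add: mult.commute)
    qed
    then show ?thesis
      by (subst eventually_sequentially_Suc[symmetric])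
  qed
  have "(\<lambda>k. f k 0) sums z 0"
    unfolding z_def
    by (intro summable_sums summable_comparison_test[OF _ summable_bound])
      (use bound \<open>b \<ge> 0\<close> in auto)
  then have "\<exists>g. \<forall>t\<in>{0..b}. (\<lambda>k. f k t) sums g t \<and>
      (g has_derivative (\<lambda>d. d *\<^sub>R h (a t) (z t))) (at t within {0..b})"
    using \<open>b \<ge> 0\<close>
    by (intro has_derivative_series[OF convex_closed_interval
          f'[unfolded has_vector_derivative_def] unif', of 0]) auto
  then obtain g where g: "\<And>t. t \<in> {0..b} \<Longrightarrow> (\<lambda>k. f k t) sums g t"
    "\<And>t. t \<in> {0..b} \<Longrightarrow> (g has_derivative (\<lambda>d. d *\<^sub>R h (a t) (z t))) (at t within {0..b})"
    by blast
  have "g t = z t" if "t \<in> {0..b}" for t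
    using g(1)[OF that] by (simp add: z_def sums_iff)
  moreover have "g 0 = v"
  proof -
    \<comment> \<open>At time 0 every later term is an integral over a single point, so only the
      initial value \<open>v\<close> survives.\<close>
    have "f k 0 = 0" if "k \<noteq> 0" for k
      using that by (cases k) (auto simp: f_def)
    then have "(\<lambda>k. f k 0) sums f 0 0"
      using sums_If_finite_set'[of "\<lambda>k. 0" 0 "{0::nat}"] sums_finite[of "{0}" "\<lambda>k. f k 0"] by simp
    then show ?thesis
      using g(1)[of 0] \<open>b \<ge> 0\<close> sums_unique2[of "\<lambda>k. f k 0"] by (auto simp: f_def)
  qed
  ultimately show thesis
    using g(2) by (intro that[of g]) (auto simp: has_vector_derivative_def)
qed

section \<open>The linearized bicycle equation\<close>

text \<open>An infinitesimal Lorentz boost: the symmetric matrix with zero diagonal blocks and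
  off-diagonal blocks \<open>- p\<close> and its transpose, an element of the Lie algebra of O(n,1).
  As it is bilinear in \<open>p\<close> and \<open>z\<close>, the preceding existence theory applies
  with coefficient \<open>p t\<close>.\<close>

definition bicycle_generator :: "'a::real_inner \<Rightarrow> 'a \<times> real \<Rightarrow> 'a \<times> real" where
  "bicycle_generator p z = (- (snd z *\<^sub>R p), - (p \<bullet> fst z))"

lemma bounded_bilinear_bicycle_generator:
  "bounded_bilinear (bicycle_generator :: 'a::real_inner \<Rightarrow> _)"
proof
  show "\<exists>K. \<forall>p z. norm (bicycle_generator p z :: 'a \<times> real) \<le> norm p * norm z * K"
  proof (intro exI allI)
    fix p :: 'a and z :: "'a \<times> real"
    have "norm (bicycle_generator p z) \<le> \<bar>snd z\<bar> * norm p + \<bar>p \<bullet> fst z\<bar>"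
      using norm_Pair_le[of "- (snd z *\<^sub>R p)" "- (p \<bullet> fst z)"]
      by (simp add: bicycle_generator_def)
    also have "\<dots> \<le> norm z * norm p + norm p * norm z"
      using norm_snd_le[of "snd z" "fst z"] norm_fst_le[of "fst z" "snd z"]
      by (intro add_mono mult_right_mono order_trans[OF Cauchy_Schwarz_ineq2] mult_left_mono) auto
    finally show "norm (bicycle_generator p z) \<le> norm p * norm z * 2"
      by simp
  qed
qed (auto simp: bicycle_generator_def algebra_simps)

text \<open>For \<open>w = u1 - u2\<close> the no-skid condition gives \<open>w' = (\<Gamma>' \<bullet> w) u1 + (\<Gamma>' \<bullet> u2) w\<close>.\<close>

lemma bicycle_motion_unique:
  fixes \<Gamma> :: "real \<Rightarrow> 'a::real_inner"
  assumes \<Gamma>: "\<And>t. t \<in> {0..b} \<Longrightarrow> (\<Gamma> has_vector_derivative p t) (at t within {0..b})"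
    and p: "continuous_on {0..b} p"
    and u1: "bicycle_motion {0..b} \<Gamma> u1" and u2: "bicycle_motion {0..b} \<Gamma> u2"
    and "u1 0 = u2 0" "t \<in> {0..b}"
  shows "u1 t = u2 t"
proof -
  have "bounded (p ` {0..b})"
    by (intro compact_imp_bounded compact_continuous_image p) simp
  then obtain B where B: "B > 0" "\<And>t. t \<in> {0..b} \<Longrightarrow> norm (p t) \<le> B"
    by (auto simp: bounded_pos)
  have ode: "\<forall>t\<in>{0..b}. u t \<in> sphere 0 1 \<and>
      (u has_vector_derivative - p t + (p t \<bullet> u t) *\<^sub>R u t) (at t within {0..b})"
    if "bicycle_motion {0..b} \<Gamma> u" for u
    using bicycle_motion_iff_ODE[OF \<Gamma>] that by (rule iffD1)
  note ode1 = ode[OF u1, rule_format] and ode2 = ode[OF u2, rule_format]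
  let ?w = "\<lambda>t. u1 t - u2 t"
  have w': "(?w has_vector_derivative (p t \<bullet> ?w t) *\<^sub>R u1 t + (p t \<bullet> u2 t) *\<^sub>R ?w t)
      (at t within {0..b})" if "t \<in> {0..b}" for t
    using has_vector_derivative_diff[OF conjunct2[OF ode1[OF that]] conjunct2[OF ode2[OF that]]]
    by (simp add: algebra_simps)
  \<comment> \<open>Each of the two summands of \<open>w'\<close> contributes at most
    \<open>B\<close> times the squared norm of \<open>w\<close>, because \<open>u1\<close> and
    \<open>u2\<close> are unit vectors; hence \<open>2 * B\<close>.\<close>
  have "?w t \<bullet> ((p t \<bullet> ?w t) *\<^sub>R u1 t + (p t \<bullet> u2 t) *\<^sub>R ?w t) \<le> (2 * B) * (?w t \<bullet> ?w t)"
    if "t \<in> {0..b}" for t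
  proof -
    let ?W = "norm (?w t)"
    have n: "norm (u1 t) = 1" "norm (u2 t) = 1"
      using ode1[OF that] ode2[OF that] by auto
    have 1: "\<bar>p t \<bullet> ?w t\<bar> \<le> B * ?W"
      by (rule order_trans[OF Cauchy_Schwarz_ineq2]) (intro mult_right_mono B that norm_ge_zero)
    have 2: "\<bar>?w t \<bullet> u1 t\<bar> \<le> ?W"
      using Cauchy_Schwarz_ineq2[of "?w t" "u1 t"] n by simp
    have 3: "\<bar>p t \<bullet> u2 t\<bar> \<le> B"
      using Cauchy_Schwarz_ineq2[of "p t" "u2 t"] n B(2)[OF that] by simp
    have "(p t \<bullet> ?w t) * (?w t \<bullet> u1 t) \<le> (B * ?W) * ?W"
      using mult_mono[OF 1 2] B(1) abs_ge_self[of "(p t \<bullet> ?w t) * (?w t \<bullet> u1 t)"]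
      by (simp add: abs_mult)
    moreover have "(p t \<bullet> u2 t) * (?W * ?W) \<le> B * (?W * ?W)"
      using 3 by (intro mult_right_mono) auto
    moreover have "?w t \<bullet> ?w t = ?W * ?W"
      by (simp add: dot_square_norm power2_eq_square)
    ultimately show ?thesis
      by (simp only: inner_add_right inner_scaleR_right)
  qed
  from gronwall_inner_eq_0[OF w' this _ \<open>t \<in> {0..b}\<close>] \<open>u1 0 = u2 0\<close> show ?thesis
    by simp
qed

lemma proj_class_scaleR:
  assumes "s \<noteq> 0"
  shows "proj_class (s *\<^sub>R z) = proj_class z"
  unfolding proj_class_def
proof (safe, goal_cases)
  case (1 _ c)
  then show ?case using assms by (intro exI[of _ "c * s"]) simp
next
  case (2 _ c)
  then show ?case using assms by (intro exI[of _ "c / s"]) simp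
qed

section \<open>The solution operator of the linear system\<close>

text \<open>\<open>Z v\<close> is some solution starting at \<open>v\<close>, chosen separately for
  each \<open>v\<close>; linear dependence on \<open>v\<close> is derived from uniqueness, not
  assumed.\<close>

locale bicycle_flow =
  fixes \<Gamma> p :: "real \<Rightarrow> 'a::euclidean_space" and b :: real
    and Z :: "'a \<times> real \<Rightarrow> real \<Rightarrow> 'a \<times> real"
  assumes b: "0 \<le> b"
    and \<Gamma>: "\<And>t. t \<in> {0..b} \<Longrightarrow> (\<Gamma> has_vector_derivative p t) (at t within {0..b})"
    and p: "continuous_on {0..b} p"
    and Z_0: "Z v 0 = v"
    and Z: "\<And>v t. t \<in> {0..b} \<Longrightarrow>
      (Z v has_vector_derivative bicycle_generator (p t) (Z v t)) (at t within {0..b})"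
begin

text \<open>The difference of two solutions solves the same linear system, and Cauchy-Schwarz
  provides the inequality that Gronwall needs.\<close>

lemma flow_unique:
  assumes w: "\<And>t. t \<in> {0..b} \<Longrightarrow>
      (w has_vector_derivative bicycle_generator (p t) (w t)) (at t within {0..b})"
    and t: "t \<in> {0..b}"
  shows "w t = Z (w 0) t"
proof -
  interpret h: bounded_bilinear "bicycle_generator :: 'a \<Rightarrow> _"
    by (rule bounded_bilinear_bicycle_generator)
  obtain L where L: "\<And>t y. t \<in> {0..b} \<Longrightarrow> norm (bicycle_generator (p t) y) \<le> L * norm y"
    using bounded_bilinear_compact_bound[OF bounded_bilinear_bicycle_generator compact_Icc p]
    by blast
  have "w t - Z (w 0) t = 0"
  proof (rule gronwall_inner_eq_0[of b "\<lambda>t. w t - Z (w 0) t"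
        "\<lambda>t. bicycle_generator (p t) (w t - Z (w 0) t)" L])
    show "((\<lambda>t. w t - Z (w 0) t) has_vector_derivative
        bicycle_generator (p t) (w t - Z (w 0) t)) (at t within {0..b})" if "t \<in> {0..b}" for t
      using has_vector_derivative_diff[OF w[OF that] Z[OF that]] by (simp add: h.diff_right)
    show "(w t - Z (w 0) t) \<bullet> bicycle_generator (p t) (w t - Z (w 0) t)
        \<le> L * ((w t - Z (w 0) t) \<bullet> (w t - Z (w 0) t))" if "t \<in> {0..b}" for t
    proof -
      let ?w = "w t - Z (w 0) t"
      have "?w \<bullet> bicycle_generator (p t) ?w \<le> norm ?w * norm (bicycle_generator (p t) ?w)"
        by (rule norm_cauchy_schwarz)
      also have "\<dots> \<le> norm ?w * (L * norm ?w)"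
        by (intro mult_left_mono L that norm_ge_zero)
      finally show ?thesis
        by (simp add: dot_square_norm power2_eq_square ac_simps)
    qed
  qed (use t Z_0 in auto)
  then show ?thesis
    by simp
qed

text \<open>Sums and multiples of solutions are solutions, so uniqueness identifies them with the
  chosen solutions for the combined initial values.\<close>

lemma linear_flow:
  assumes t: "t \<in> {0..b}"
  shows "linear (\<lambda>v. Z v t)"
proof (rule linearI)
  interpret h: bounded_bilinear "bicycle_generator :: 'a \<Rightarrow> _"
    by (rule bounded_bilinear_bicycle_generator)
  show "Z (v + w) t = Z v t + Z w t" for v w
    using flow_unique[OF _ t, of "\<lambda>s. Z v s + Z w s"] has_vector_derivative_add[OF Z Z]
    by (simp add: Z_0 h.add_right)
  show "Z (c *\<^sub>R v) t = c *\<^sub>R Z v t" for c v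
    using flow_unique[OF _ t, of "\<lambda>s. c *\<^sub>R Z v s"]
      bounded_linear.has_vector_derivative[OF bounded_linear_scaleR_right Z]
    by (simp add: Z_0 h.scaleR_right)
qed

lemma fst_flow:
  assumes "t \<in> {0..b}"
  shows "((\<lambda>s. fst (Z v s)) has_vector_derivative - (snd (Z v t) *\<^sub>R p t)) (at t within {0..b})"
  using bounded_linear.has_vector_derivative[OF bounded_linear_fst Z[OF assms]]
  by (simp add: bicycle_generator_def)

lemma snd_flow:
  assumes "t \<in> {0..b}"
  shows "((\<lambda>s. snd (Z v s)) has_real_derivative - (p t \<bullet> fst (Z v t))) (at t within {0..b})"
  using bounded_linear.has_vector_derivative[OF bounded_linear_snd Z[OF assms]]
  by (simp add: bicycle_generator_def has_real_derivative_iff_has_vector_derivative)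

lemma snd_flow_square:
  assumes "t \<in> {0..b}"
  shows "((\<lambda>s. (snd (Z v s))\<^sup>2) has_vector_derivative
      - 2 * snd (Z v t) * (p t \<bullet> fst (Z v t))) (at t within {0..b})"
  using snd_flow[OF assms, of v] unfolding has_real_derivative_iff_has_vector_derivative[symmetric]
  by (auto intro!: derivative_eq_intros)

text \<open>With \<open>(y, s)\<close> the solution, \<open>s\<^sup>2\<close> and
  \<open>y \<bullet> y\<close> both have derivative \<open>- 2 * s * (p \<bullet> y)\<close>, so
  their difference is constant.\<close>

lemma lorentz_form_flow:
  assumes t: "t \<in> {0..b}"
  shows "lorentz_form (Z v t) = lorentz_form v"
proof -
  have "((\<lambda>s. lorentz_form (Z v s)) has_vector_derivative 0) (at s within {0..b})"
    if "s \<in> {0..b}" for s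
    using has_vector_derivative_diff[OF snd_flow_square[OF that]
        has_vector_derivative_inner_self[OF fst_flow[OF that]], of v v]
    by (simp add: lorentz_form_def inner_commute)
  then have "lorentz_form (Z v t) = lorentz_form (Z v 0)"
    using t b by (intro has_derivative_zero_unique[OF convex_closed_interval[of 0 b]])
      (auto simp: has_vector_derivative_def)
  then show ?thesis
    by (simp add: Z_0)
qed

lemma flow_in_moebius_group: "(\<lambda>v. Z v b) \<in> moebius_group"
  using b linear_flow lorentz_form_flow by (simp add: moebius_group_def)

section \<open>Null initial vectors and the bicycle motion\<close>

context
  fixes r :: 'a
  assumes r: "norm r = 1"
begin

lemma norm_fst_flow:
  assumes "t \<in> {0..b}"
  shows "norm (fst (Z (r, 1) t)) = \<bar>snd (Z (r, 1) t)\<bar>"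
proof -
  have "lorentz_form (Z (r, 1) t) = 0"
    unfolding lorentz_form_flow[OF assms] using r by (simp add: lorentz_form_def dot_square_norm)
  then have "(norm (fst (Z (r, 1) t)))\<^sup>2 = (snd (Z (r, 1) t))\<^sup>2"
    by (simp add: lorentz_form_def dot_square_norm)
  then show ?thesis
    by (metis abs_ge_zero norm_ge_zero power2_abs power2_eq_imp_eq)
qed

text \<open>This makes the quotient \<open>y / s\<close> meaningful at all times. On the null cone
  \<open>y\<close> and \<open>s\<close> have equal size, so \<open>s\<^sup>2\<close> decays at a
  relative rate of at most \<open>2 * B\<close>; starting from 1, it cannot reach 0.\<close>

lemma snd_flow_nonzero:
  assumes t: "t \<in> {0..b}"
  shows "snd (Z (r, 1) t) \<noteq> 0"
proof -
  let ?y = "\<lambda>t. fst (Z (r, 1) t)" and ?s = "\<lambda>t. snd (Z (r, 1) t)"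
  have "bounded (p ` {0..b})"
    by (intro compact_imp_bounded compact_continuous_image p) simp
  then obtain B where B: "B > 0" "\<And>t. t \<in> {0..b} \<Longrightarrow> norm (p t) \<le> B"
    by (auto simp: bounded_pos)
  \<comment> \<open>Gronwall yields upper bounds only; the lower bound on \<open>s\<^sup>2\<close>
    comes from applying it to \<open>- s\<^sup>2\<close> with the negative rate
    \<open>- (2 * B)\<close>.\<close>
  have "- (?s t)\<^sup>2 \<le> - (?s 0)\<^sup>2 * exp (- (2 * B) * t)"
  proof (rule gronwall_differential[OF has_vector_derivative_minus[OF snd_flow_square] _ t])
    fix t assume t: "t \<in> {0..b}"
    have "\<bar>p t \<bullet> ?y t\<bar> \<le> B * \<bar>?s t\<bar>"
      using Cauchy_Schwarz_ineq2[of "p t" "?y t"] norm_fst_flow[OF t]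
        mult_right_mono[OF B(2)[OF t], of "\<bar>?s t\<bar>"] by simp
    then have "\<bar>?s t\<bar> * \<bar>p t \<bullet> ?y t\<bar> \<le> \<bar>?s t\<bar> * (B * \<bar>?s t\<bar>)"
      by (intro mult_left_mono) auto
    then have "?s t * (p t \<bullet> ?y t) \<le> B * (?s t)\<^sup>2"
      using abs_ge_self[of "?s t * (p t \<bullet> ?y t)"]
      by (simp add: abs_mult power2_eq_square ac_simps)
    then show "- (- 2 * ?s t * (p t \<bullet> ?y t)) \<le> - (2 * B) * - (?s t)\<^sup>2"
      by simp
  qed
  moreover have "exp (- (2 * B) * t) > 0"
    by simp
  ultimately show ?thesis
    by (auto simp: Z_0)
qed

text \<open>For \<open>u = y / s\<close> the quotient rule gives
  \<open>u' = y' / s - (s' / s\<^sup>2) y = - p + (p \<bullet> u) u\<close>; the norm is 1 because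
  the solution stays on the null cone.\<close>

lemma bicycle_motion_flow:
  "bicycle_motion {0..b} \<Gamma> (\<lambda>t. fst (Z (r, 1) t) /\<^sub>R snd (Z (r, 1) t))"
proof (rule iffD2[OF bicycle_motion_iff_ODE[OF \<Gamma>]], assumption, intro ballI conjI)
  let ?y = "\<lambda>t. fst (Z (r, 1) t)" and ?s = "\<lambda>t. snd (Z (r, 1) t)"
  fix t assume t: "t \<in> {0..b}"
  note s0 = snd_flow_nonzero[OF t]
  show "?y t /\<^sub>R ?s t \<in> sphere 0 1"
    using norm_fst_flow[OF t] s0 by simp
  have "((\<lambda>t. inverse (?s t)) has_real_derivative (p t \<bullet> ?y t) / (?s t)\<^sup>2) (at t within {0..b})"
    using DERIV_inverse_fun[OF snd_flow[OF t] s0]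
    by (simp add: power2_eq_square field_simps)
  from has_vector_derivative_scaleR[OF this fst_flow[OF t]]
  show "((\<lambda>t. ?y t /\<^sub>R ?s t) has_vector_derivative
      - p t + (p t \<bullet> (?y t /\<^sub>R ?s t)) *\<^sub>R (?y t /\<^sub>R ?s t)) (at t within {0..b})"
    by (rule has_vector_derivative_eq_rhs) (use s0 in \<open>simp add: power2_eq_square divide_simps\<close>)
qed

text \<open>The definite description is resolved by existence, from the quotient of the linear flow,
  and by uniqueness of bicycle motions.\<close>

lemma monodromy_eq_flow: "monodromy \<Gamma> b r = fst (Z (r, 1) b) /\<^sub>R snd (Z (r, 1) b)"
  unfolding monodromy_def
proof (rule the_equality)
  let ?u = "\<lambda>t. fst (Z (r, 1) t) /\<^sub>R snd (Z (r, 1) t)"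
  have u0: "?u 0 = r"
    by (simp add: Z_0)
  then show "\<exists>u. bicycle_motion {0..b} \<Gamma> u \<and> u 0 = r \<and> u b = ?u b"
    using bicycle_motion_flow by (intro exI[of _ ?u]) auto
  fix w assume "\<exists>u. bicycle_motion {0..b} \<Gamma> u \<and> u 0 = r \<and> u b = w"
  then obtain u where u: "bicycle_motion {0..b} \<Gamma> u" "u 0 = r" "u b = w"
    by blast
  then show "w = ?u b"
    using bicycle_motion_unique[OF \<Gamma> p u(1) bicycle_motion_flow, of b] u0 b by auto
qed

end

text \<open>The flow sends \<open>(r, 1)\<close> to a nonzero multiple of
  \<open>(monodromy \<Gamma> b r, 1)\<close>. The multiple disappears in the projective class, and
  linearity carries the whole class along.\<close>

lemma flow_induces_monodromy: "induces_on_sphere (\<lambda>v. Z v b) (monodromy \<Gamma> b)"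
  unfolding induces_on_sphere_def
proof (intro ballI conjI)
  fix r :: 'a assume "r \<in> sphere 0 1"
  then have r: "norm r = 1"
    by simp
  have bb: "b \<in> {0..b}"
    using b by simp
  interpret linear "\<lambda>v. Z v b"
    using bb by (rule linear_flow)
  let ?y = "fst (Z (r, 1) b)" and ?s = "snd (Z (r, 1) b)"
  note s0 = snd_flow_nonzero[OF r bb]
  show "monodromy \<Gamma> b r \<in> sphere 0 1"
    using norm_fst_flow[OF r bb] s0 by (simp add: monodromy_eq_flow[OF r])
  have *: "Z (r, 1) b = ?s *\<^sub>R (monodromy \<Gamma> b r, 1)"
    using s0 by (simp add: monodromy_eq_flow[OF r] prod_eq_iff)
  have "(\<lambda>v. Z v b) ` sphere_class r = proj_class (Z (r, 1) b)"
    by (auto simp only: sphere_class_def proj_class_def scale image_iff set_eq_iff mem_Collect_eq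
        Bex_def)
  also have "\<dots> = sphere_class (monodromy \<Gamma> b r)"
    unfolding sphere_class_def by (subst *) (rule proj_class_scaleR[OF s0])
  finally show "(\<lambda>v. Z v b) ` sphere_class r = sphere_class (monodromy \<Gamma> b r)" .
qed

end

section \<open>Application to smooth curves\<close>

text \<open>The first derivative is itself differentiable, hence continuous; this is all the
  regularity that the flow requires.\<close>

lemma smooth_curve_on_C1:
  assumes "smooth_curve_on I \<Gamma>"
  obtains p where "continuous_on I p"
    "\<And>t. t \<in> I \<Longrightarrow> (\<Gamma> has_vector_derivative p t) (at t within I)"
proof -
  obtain D where D0: "\<And>t. t \<in> I \<Longrightarrow> D 0 t = \<Gamma> t"
    and D: "\<And>k t. t \<in> I \<Longrightarrow> (D k has_vector_derivative D (Suc k) t) (at t within I)"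
    using assms unfolding smooth_curve_on_def by blast
  have "continuous_on I (D 1)"
    unfolding continuous_on_eq_continuous_within
    using has_vector_derivative_continuous[OF D] by blast
  moreover have "(\<Gamma> has_vector_derivative D 1 t) (at t within I)" if "t \<in> I" for t
    using has_vector_derivative_transform[OF that D0[symmetric] D[OF that, of 0]] by simp
  ultimately show thesis
    by (rule that)
qed

theorem theorem3p1:
  fixes \<Gamma> :: "real \<Rightarrow> real ^ 'n" and I :: "real set"
  assumes "CARD('n) \<ge> 2"
    and "is_interval I" and "0 \<in> I" and "I \<subseteq> {0..}"
    and "smooth_curve_on I \<Gamma>"
  shows "\<forall>x\<in>I. \<exists>g\<in>moebius_group. induces_on_sphere g (monodromy \<Gamma> x)"
proof
  fix x assume x: "x \<in> I"
  then have "0 \<le> x"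
    using \<open>I \<subseteq> {0..}\<close> by auto
  have sub: "{0..x} \<subseteq> I"
    using mem_is_interval_1_I[OF \<open>is_interval I\<close> \<open>0 \<in> I\<close> x] by auto
  obtain p where "continuous_on I p"
    and "\<And>t. t \<in> I \<Longrightarrow> (\<Gamma> has_vector_derivative p t) (at t within I)"
    using smooth_curve_on_C1[OF \<open>smooth_curve_on I \<Gamma>\<close>] by blast
  \<comment> \<open>Derivatives are restricted from \<open>I\<close> to \<open>{0..x}\<close>, since
    \<open>monodromy \<Gamma> x\<close> refers to motions on that interval.\<close>
  then have p: "continuous_on {0..x} p"
    and \<Gamma>: "\<And>t. t \<in> {0..x} \<Longrightarrow> (\<Gamma> has_vector_derivative p t) (at t within {0..x})"
    using sub by (blast intro: continuous_on_subset has_vector_derivative_within_subset)+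
  have "\<exists>z. z 0 = v \<and> (\<forall>t\<in>{0..x}.
      (z has_vector_derivative bicycle_generator (p t) (z t)) (at t within {0..x}))" for v
    using linear_ode_exists[OF bounded_bilinear_bicycle_generator p \<open>0 \<le> x\<close>] by metis
  \<comment> \<open>One solution is chosen for every initial vector, as the locale expects.\<close>
  then obtain Z where "\<And>v. Z v 0 = v" and "\<And>v t. t \<in> {0..x} \<Longrightarrow>
      (Z v has_vector_derivative bicycle_generator (p t) (Z v t)) (at t within {0..x})"
    by metis
  then interpret bicycle_flow \<Gamma> p x Z
    using \<open>0 \<le> x\<close> \<Gamma> p by unfold_locales auto
  show "\<exists>g\<in>moebius_group. induces_on_sphere g (monodromy \<Gamma> x)"
    using flow_in_moebius_group flow_induces_monodromy by blast
qed

end
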